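(* For every integer $n\ge 1$, the Hankel determinants of the polynomials $c_m(t)$ satisfy, as identities of polynomials in $t$, $$\det\left(c_{i+j}(t)\right)_{i,j=0}^{n-1}=t^{\binom{n}{2}}\qquad\text{and}\qquad \det\left(c_{i+j+1}(t)\right)_{i,j=0}^{n-1}=(-t)^{\binom{n}{2}}.$$
   Context: The polynomials $c_n(t)$ are the $q$-Narayana polynomials $C_n(t;q)=\sum_{k=0}^{n-1} q^{k^2+k}{n \brack k}_q{n-1 \brack k}_q\frac{t^k}{[k+1]_q}$ ($n>0$), $C_0(t;q)=1$, evaluated at $q=-1$ (the coefficients of $t^k$ are polynomials in $q$, so this makes sense; here $[m]_q=1+q+\dots+q^{m-1}$ and ${n \brack k}_q$ is the $q$-binomial coefficient). Explicitly, $c_0(t)=1$ and for $n\ge 1$ $$c_n(t)=\sum_{k=0}^{n} v(n,k)\,t^k,\qquad v(n,k)=\binom{\lfloor (n-1)/2\rfloor}{\lfloor k/2\rfloor}\binom{\lfloor n/2\rfloor}{\lfloor (k+1)/2\rfloor},$$ where $\binom{a}{b}=0$ for integers $b>a\ge 0$. The first terms are $1,\,1,\,1+t,\,1+t+t^2,\,1+2t+2t^2+t^3,\dots$. The variable $t$ is an indeterminate. *)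

theory Defs
  imports "Jordan_Normal_Form.Determinant" "HOL-Computational_Algebra.Polynomial"
begin

(* The inner type int poly consists of polynomials in q.  The divisions below are
   polynomial divisions; q_binomial_exact and q_narayana_coeff_exact show that they
   leave no remainder. *)

definition q_bracket :: "nat \<Rightarrow> int poly" where
  "q_bracket m = (\<Sum>i<m. monom 1 i)"

definition q_fact :: "nat \<Rightarrow> int poly" where
  "q_fact n = (\<Prod>m=1..n. q_bracket m)"

definition q_binomial :: "nat \<Rightarrow> nat \<Rightarrow> int poly" where
  "q_binomial n k =
     (if k \<le> n then q_fact n div (q_fact k * q_fact (n - k)) else 0)"

definition q_narayana_coeff :: "nat \<Rightarrow> nat \<Rightarrow> int poly" where
  "q_narayana_coeff n k =
     (monom 1 (k\<^sup>2 + k) * q_binomial n k * q_binomial (n - 1) k) div q_bracket (k + 1)"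

(* A polynomial in t (outer poly) with coefficients in Z[q] (inner poly). *)
definition q_narayana :: "nat \<Rightarrow> int poly poly" where
  "q_narayana n =
     (if n = 0 then 1 else (\<Sum>k=0..n-1. monom (q_narayana_coeff n k) k))"

(* Evaluation of every coefficient at q = -1. *)
definition c_poly :: "nat \<Rightarrow> int poly" where
  "c_poly n = map_poly (\<lambda>p. poly p (-1)) (q_narayana n)"

lemma q_bracket_add: "q_bracket (a + b) = q_bracket a + monom 1 a * q_bracket b"
proof -
  have "q_bracket (a + b) = q_bracket a + (\<Sum>i<b. monom 1 (a + i))"
    unfolding q_bracket_def by (induction b) (auto simp: algebra_simps)
  then show ?thesis
    unfolding q_bracket_def by (simp add: sum_distrib_left mult_monom)
qed

lemma q_bracket_Suc: "q_bracket (Suc k) = 1 + monom 1 1 * q_bracket k"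
  using q_bracket_add[of 1 k] by (simp add: q_bracket_def)

lemma q_bracket_nonzero: "m > 0 \<Longrightarrow> q_bracket m \<noteq> 0"
proof
  assume "m > 0" and "q_bracket m = 0"
  then have "coeff (q_bracket m) 0 = 0" by simp
  moreover have "coeff (q_bracket m) 0 = 1"
    using \<open>m > 0\<close> by (cases m) (auto simp: q_bracket_Suc coeff_mult)
  ultimately show False by simp
qed

lemma q_fact_0 [simp]: "q_fact 0 = 1"
  by (simp add: q_fact_def)

lemma q_fact_Suc: "q_fact (Suc n) = q_bracket (Suc n) * q_fact n"
  by (simp add: q_fact_def mult.commute)

lemma q_fact_nonzero: "q_fact n \<noteq> 0"
  by (induction n) (auto simp: q_fact_Suc q_bracket_nonzero)

lemma q_fact_dvd: "q_fact a * q_fact b dvd q_fact (a + b)"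
proof (induction "a + b" arbitrary: a b)
  case 0
  then show ?case by simp
next
  case (Suc n)
  show ?case
  proof (cases "a = 0 \<or> b = 0")
    case True
    then show ?thesis by auto
  next
    case False
    then obtain a' b' where ab: "a = Suc a'" "b = Suc b'"
      by (meson not0_implies_Suc)
    have n: "n = a' + b" "n = a + b'" using Suc(2) ab by auto
    have 1: "q_fact a * q_fact b dvd q_bracket a * q_fact n"
      using Suc(1)[OF n(1)] n(1) unfolding ab(1) q_fact_Suc mult.assoc
      by (metis mult_dvd_mono dvd_refl)
    have 2: "q_fact a * q_fact b dvd q_bracket b * q_fact n"
      using Suc(1)[OF n(2)] n(2) unfolding ab(2) q_fact_Suc
      by (metis mult_dvd_mono dvd_refl mult.left_commute)
    have "q_fact (a + b) = q_bracket a * q_fact n + monom 1 a * (q_bracket b * q_fact n)"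
      by (simp add: Suc(2)[symmetric] q_fact_Suc)
         (simp add: Suc(2) q_bracket_add algebra_simps)
    then show ?thesis using 1 2 by (metis dvd_add dvd_mult)
  qed
qed

lemma q_binomial_exact:
  assumes "k \<le> n"
  shows "q_binomial n k * (q_fact k * q_fact (n - k)) = q_fact n"
  using q_fact_dvd[of k "n - k"] assms by (simp add: q_binomial_def)

lemma q_binomial_Suc_right:
  assumes "k < n"
  shows "q_bracket (Suc k) * q_binomial n (Suc k) = q_bracket (n - k) * q_binomial n k"
proof -
  have nk: "n - k = Suc (n - Suc k)" using assms by simp
  have "q_binomial n (Suc k) * (q_fact (Suc k) * q_fact (n - Suc k))
      = q_binomial n k * (q_fact k * q_fact (n - k))"
    using assms by (simp add: q_binomial_exact)
  then have "(q_fact k * q_fact (n - Suc k)) * (q_bracket (Suc k) * q_binomial n (Suc k))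
      = (q_fact k * q_fact (n - Suc k)) * (q_bracket (n - k) * q_binomial n k)"
    unfolding nk q_fact_Suc by (simp add: algebra_simps)
  then show ?thesis by (simp add: q_fact_nonzero)
qed

lemma q_binomial_product_exact:
  assumes "k < n"
  shows "q_bracket (k + 1) dvd q_binomial n k * q_binomial (n - 1) k"
proof (cases k)
  case 0
  then show ?thesis by (simp add: q_bracket_def)
next
  case (Suc j)
  let ?A = "q_binomial n k" and ?B = "q_binomial (n - 1) k"
  let ?C = "q_binomial n (Suc k)" and ?D = "q_binomial (n - 1) j"
  have C: "q_bracket (Suc k) * ?C = q_bracket (n - k) * ?A"
    using assms by (rule q_binomial_Suc_right)
  have D: "q_bracket k * ?B = q_bracket (n - k) * ?D"
    using q_binomial_Suc_right[of j "n - 1"] assms Suc by simp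
  have "q_bracket (Suc k) * (?A * ?B - monom 1 1 * ?C * ?D)
      = q_bracket (Suc k) * ?A * ?B - monom 1 1 * (q_bracket (Suc k) * ?C) * ?D"
    by (simp add: algebra_simps)
  also have "\<dots> = q_bracket (Suc k) * ?A * ?B - monom 1 1 * ?A * (q_bracket (n - k) * ?D)"
    unfolding C by (simp add: algebra_simps)
  also have "\<dots> = ?A * ?B"
    unfolding D[symmetric] q_bracket_Suc by (simp add: algebra_simps)
  finally show ?thesis by (metis dvd_triv_left Suc_eq_plus1)
qed

lemma q_narayana_coeff_exact:
  assumes "k < n"
  shows "q_narayana_coeff n k * q_bracket (k + 1) =
           monom 1 (k\<^sup>2 + k) * q_binomial n k * q_binomial (n - 1) k"
  using q_binomial_product_exact[OF assms]
  by (simp add: q_narayana_coeff_def mult.assoc)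

end

theory Submission
  imports Defs
begin

text \<open>
  The generating function of the polynomials \<open>c_n(t)\<close> is a Stieltjes continued fraction
  \<open>1/(1 - a_0 x/(1 - a_1 x/(1 - a_2 x/...)))\<close> whose coefficients
  \<open>1, t, -1, -t, 1, t, -1, -t, ...\<close> have period four. Equivalently,
  \<open>c_n(t)\<close> is the total weight of the Dyck paths of length \<open>2 n\<close>, where a down step to height
  \<open>k\<close> has weight \<open>a_k\<close> (\<open>c_poly_eq_dyck\<close>). Both determinants follow from this.

  Cutting a Dyck path of length \<open>p + q\<close> after \<open>p\<close> steps (\<open>dyck_gluing\<close>) factors each Hankel matrix
  into a lower unitriangular matrix and an upper triangular one, with the products
  \<open>a_0 ... a_{2k-1}\<close>, respectively \<open>a_0 ... a_{2k}\<close>, on the diagonal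
  (\<open>det_hankel_dyck\<close>). For the weights above these products are \<open>t^k\<close> and \<open>(-t)^k\<close>.

  It remains to count the weighted paths. Since two consecutive odd lengths are related by
  a three-term recurrence with coefficients \<open>(-1)^k (1 + t)\<close> and \<open>-t\<close> (\<open>dyck_wt_odd_Suc\<close>), the
  weighted counts of prefixes of odd length can be guessed and checked: up to simple factors they
  are the polynomials with coefficients \<open>C(m, k div 2) C(m, (k+1) div 2 + j)\<close>, which satisfy
  recurrences that come down to Pascal's rule (\<open>dyck_wt_odd\<close>). For \<open>j = 0\<close> they are the
  \<open>c_{2m+1}\<close>, and \<open>c_{2m+2} = (1 + t) c_{2m+1}\<close>. The explicit form of the
  coefficients of \<open>c_n\<close> comes from the values of \<open>q\<close>-binomial coefficients at \<open>q = -1\<close>.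
\<close>

section \<open>Weighted Dyck prefixes and Hankel determinants\<close>

text \<open>
  The total weight of the lattice paths with \<open>n\<close> steps \<open>+1\<close> or \<open>-1\<close> that start at height \<open>0\<close>, end
  at height \<open>k\<close> and stay nonnegative, where a step from \<open>k + 1\<close> down to \<open>k\<close> has weight \<open>a k\<close>.
\<close>

primrec dyck :: "(nat \<Rightarrow> 'a::comm_ring_1) \<Rightarrow> nat \<Rightarrow> nat \<Rightarrow> 'a" where
  "dyck a 0 k = (if k = 0 then 1 else 0)"
| "dyck a (Suc n) k = (if k = 0 then 0 else dyck a n (k - 1)) + a k * dyck a n (Suc k)"

lemma dyck_eq_0: "n < k \<Longrightarrow> dyck a n k = 0"
  by (induction n arbitrary: k) auto

lemma dyck_diag [simp]: "dyck a n n = 1"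
  by (induction n) (auto simp: dyck_eq_0)

lemma dyck_parity: "odd (n + k) \<Longrightarrow> dyck a n k = 0"
proof (induction n arbitrary: k)
  case (Suc n)
  then show ?case by (cases k) auto
qed (auto elim: oddE)

text \<open>
  A Dyck path of length \<open>p + q\<close> at height \<open>k\<close> after \<open>p\<close> steps is a prefix followed by the reversal
  of another prefix; reversing turns up steps into down steps, and the product \<open>a 0 ... a (k - 1)\<close>
  corrects the weight. Algebraically, one step can be moved from the first factor to the second,
  because the one-step transition operator is self-adjoint for these products as weights.
\<close>

lemma dyck_gluing:
  assumes "p < N"
  shows "(\<Sum>k<N. dyck a p k * dyck a q k * (\<Prod>i<k. a i)) = dyck a (p + q) 0"
  using assms
proof (induction p arbitrary: q)
  case 0
  then obtain M where "N = Suc M" by (cases N) auto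
  then show ?case by (simp add: sum.lessThan_Suc_shift del: sum.lessThan_Suc)
next
  case (Suc p)
  then obtain M where N: "N = Suc M" and pM: "p < M" by (cases N) auto
  let ?w = "\<lambda>k. \<Prod>i<k. a i"
  \<comment> \<open>Up to boundary terms the right-hand side is symmetric in \<open>r\<close> and \<open>s\<close>.\<close>
  have split: "(\<Sum>k<N. dyck a (Suc r) k * dyck a s k * ?w k)
      = (\<Sum>k<M. dyck a r k * dyck a s (Suc k) * ?w (Suc k))
      + (\<Sum>k<N. dyck a r (Suc k) * dyck a s k * ?w (Suc k))" for r s
  proof -
    have "(\<Sum>k<N. dyck a (Suc r) k * dyck a s k * ?w k)
        = (\<Sum>k<N. (if k = 0 then 0 else dyck a r (k - 1)) * dyck a s k * ?w k)
        + (\<Sum>k<N. dyck a r (Suc k) * dyck a s k * ?w (Suc k))"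
      by (simp add: sum.distrib [symmetric] algebra_simps)
    also have "(\<Sum>k<N. (if k = 0 then 0 else dyck a r (k - 1)) * dyck a s k * ?w k)
        = (\<Sum>k<M. dyck a r k * dyck a s (Suc k) * ?w (Suc k))"
      unfolding N sum.lessThan_Suc_shift by simp
    finally show ?thesis .
  qed
  have "(\<Sum>k<N. dyck a (Suc p) k * dyck a q k * ?w k)
      = (\<Sum>k<N. dyck a (Suc q) k * dyck a p k * ?w k)"
    using pM unfolding split[of p q] split[of q p]
    by (simp add: N dyck_eq_0 mult.commute)
  also have "\<dots> = (\<Sum>k<N. dyck a p k * dyck a (Suc q) k * ?w k)"
    by (simp add: mult.commute)
  also have "\<dots> = dyck a (p + Suc q) 0"
    by (rule Suc.IH) (use Suc.prems in simp)
  finally show ?case by (simp only: add_Suc add_Suc_right)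
qed

lemma sum_lessThan_double: "(\<Sum>k<2 * n. f k) = (\<Sum>k<n. f (2 * k) + f (2 * k + 1 :: nat))"
  for f :: "nat \<Rightarrow> 'a::comm_monoid_add"
  by (induction n) (auto simp: algebra_simps)

text \<open>
  Heights have the parity of the number of steps, so only half of the summands survive. The two
  choices of \<open>e\<close> correspond to the even and odd contractions of the continued fraction.
\<close>

lemma dyck_gluing_parity:
  assumes e: "e < 2" and i: "i < n"
  shows "(\<Sum>k<n. dyck a (2 * i + e) (2 * k + e) *
            ((\<Prod>l<2 * k + e. a l) * dyck a (2 * j + e) (2 * k + e)))
         = dyck a (2 * (i + j + e)) 0"
proof -
  have eq: "(2 * i + e) + (2 * j + e) = 2 * (i + j + e)" by simp
  have "2 * i + e < 2 * n" using e i by simp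
  from dyck_gluing[OF this, of a "2 * j + e"]
  show ?thesis
    unfolding eq sum_lessThan_double
    using e by (cases "e = 0")
      (simp_all add: dyck_parity less_2_cases_iff mult_ac del: dyck.simps(2))
qed

lemma det_hankel_dyck:
  assumes e: "e < 2"
  shows "det (mat n n (\<lambda>(i, j). dyck a (2 * (i + j + e)) 0)) = (\<Prod>k<n. \<Prod>l<2 * k + e. a l)"
proof -
  define L where "L = mat n n (\<lambda>(i, k). dyck a (2 * i + e) (2 * k + e))"
  define R where "R = mat n n (\<lambda>(k, j). (\<Prod>l<2 * k + e. a l) * dyck a (2 * j + e) (2 * k + e))"
  have LR: "L \<in> carrier_mat n n" "R \<in> carrier_mat n n" by (auto simp: L_def R_def)
  have "mat n n (\<lambda>(i, j). dyck a (2 * (i + j + e)) 0) = L * R"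
    by (rule eq_matI)
       (auto simp: L_def R_def scalar_prod_def lessThan_atLeast0[symmetric]
          dyck_gluing_parity[OF e])
  moreover have "det L = 1"
    using det_lower_triangular[OF _ LR(1)]
    by (simp add: prod_list_diag_prod L_def dyck_eq_0 del: dyck.simps(2))
  moreover have "det R = (\<Prod>k<n. \<Prod>l<2 * k + e. a l)"
  proof -
    have "upper_triangular R" by (auto simp: R_def dyck_eq_0)
    then have "det R = prod_list (diag_mat R)" by (rule det_upper_triangular[OF _ LR(2)])
    also have "\<dots> = (\<Prod>k<n. \<Prod>l<2 * k + e. a l)"
      by (simp add: prod_list_diag_prod R_def lessThan_atLeast0)
    finally show ?thesis .
  qed
  ultimately show ?thesis using LR by (simp add: det_mult)
qed

section \<open>Weights of period four\<close>

text \<open>The sequence \<open>1, t, -1, -t\<close>, repeated.\<close>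

definition wt :: "'a::comm_ring_1 \<Rightarrow> nat \<Rightarrow> 'a" where
  "wt t k = (-1) ^ (k div 2) * (if even k then 1 else t)"

lemma prod_wt_even: "(\<Prod>l<2 * k. wt t l) = t ^ k"
  by (induction k) (auto simp: wt_def algebra_simps power_mult_distrib[symmetric])

lemma prod_wt_odd: "(\<Prod>l<2 * k + 1. wt t l) = (- t) ^ k"
proof -
  have "(\<Prod>l<2 * k + 1. wt t l) = t ^ k * wt t (2 * k)"
    by (simp add: prod_wt_even)
  also have "\<dots> = (- t) ^ k"
    by (simp add: wt_def power_minus[of t] mult.commute)
  finally show ?thesis .
qed

lemma prod_power_choose_2: "(\<Prod>k<n. x ^ k) = x ^ (n choose 2)"
  for x :: "'a::comm_monoid_mult"
  by (induction n) (auto simp: power_add[symmetric] numeral_2_eq_2 add.commute)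

text \<open>
  The product \<open>t^j * binom_pair_poly m j\<close> is the coefficient of \<open>y^j\<close> in the Laurent polynomial
  \<open>(1 + 1/y) (1 + t y)^m (1 + t/y)^m\<close> in \<open>y\<close>. The even powers of \<open>t\<close> come from the summand
  \<open>1\<close> and the odd ones from \<open>1/y\<close>, which explains the rounding. Multiplication by
  \<open>(1 + t y) (1 + t/y) = 1 + t^2 + t (y + 1/y)\<close> gives the recurrences in \<open>m\<close>.
\<close>

definition binom_pair_poly :: "nat \<Rightarrow> nat \<Rightarrow> int poly" where
  "binom_pair_poly m j =
     (\<Sum>k\<le>2 * m. monom (int (m choose (k div 2)) * int (m choose ((k + 1) div 2 + j))) k)"

lemma coeff_ballot:
  "coeff (binom_pair_poly m j) k = int (m choose (k div 2)) * int (m choose ((k + 1) div 2 + j))"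
proof (cases "k \<le> 2 * m")
  case False
  then have "(k + 1) div 2 + j > m" by auto
  with False show ?thesis by (simp add: binom_pair_poly_def coeff_sum)
qed (simp add: binom_pair_poly_def coeff_sum)

lemma binom_pair_poly_0 [simp]: "binom_pair_poly 0 0 = 1" "binom_pair_poly 0 (Suc j) = 0"
  by (simp_all add: binom_pair_poly_def)

lemma binom_pair_poly_Suc_Suc:
  "binom_pair_poly (Suc m) (Suc j) = binom_pair_poly m j + (1 + [:0, 1:]\<^sup>2) * binom_pair_poly m (Suc j)
     + [:0, 1:]\<^sup>2 * binom_pair_poly m (Suc (Suc j))"
proof (rule poly_eqI)
  fix k
  consider "k = 0" | "k = 1" | l where "k = Suc (Suc l)"
    by (metis One_nat_def not0_implies_Suc)
  then show "coeff (binom_pair_poly (Suc m) (Suc j)) k = coeff (binom_pair_poly m j + (1 + [:0, 1:]\<^sup>2) * binom_pair_poly m (Suc j)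
     + [:0, 1:]\<^sup>2 * binom_pair_poly m (Suc (Suc j))) k"
    by cases (auto simp: coeff_ballot power2_eq_square algebra_simps coeff_pCons)
qed

text \<open>
  At the boundary the neighbour on the left is the coefficient of \<open>1/y\<close>. It equals the one of
  \<open>y^0\<close>, because \<open>(1 + t y)^m (1 + t/y)^m\<close> is symmetric in \<open>y\<close> and \<open>1/y\<close>; this explains the
  extra summand \<open>t\<close>.
\<close>

lemma binom_pair_poly_Suc_0:
  "binom_pair_poly (Suc m) 0 = (1 + [:0, 1:] + [:0, 1:]\<^sup>2) * binom_pair_poly m 0 + [:0, 1:]\<^sup>2 * binom_pair_poly m (Suc 0)"
proof (rule poly_eqI)
  fix k
  consider "k = 0" | "k = 1" | l where "k = Suc (Suc l)"
    by (metis One_nat_def not0_implies_Suc)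
  then show "coeff (binom_pair_poly (Suc m) 0) k =
     coeff ((1 + [:0, 1:] + [:0, 1:]\<^sup>2) * binom_pair_poly m 0 + [:0, 1:]\<^sup>2 * binom_pair_poly m (Suc 0)) k"
    by cases (auto simp: coeff_ballot power2_eq_square algebra_simps coeff_pCons)
qed

text \<open>
  Two steps at once: for odd heights \<open>2 k + 1\<close>, a level pair of steps is a down step followed by an
  up step or conversely, with weight \<open>a_{2k} + a_{2k+1} = (-1)^k (1 + t)\<close>, and the descent from
  \<open>2 k + 3\<close> has weight \<open>a_{2k+1} a_{2k+2} = -t\<close>.
\<close>

lemma dyck_wt_odd_Suc:
  "dyck (wt t) (2 * Suc n + 1) (2 * k + 1) =
     (if k = 0 then 0 else dyck (wt t) (2 * n + 1) (2 * (k - 1) + 1))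
     + (-1) ^ k * (1 + t) * dyck (wt t) (2 * n + 1) (2 * k + 1)
     - t * dyck (wt t) (2 * n + 1) (2 * Suc k + 1)"
proof -
  have "dyck a (Suc (Suc m)) (Suc l) =
     (if l = 0 then 0 else dyck a m (l - 1)) + (a l + a (Suc l)) * dyck a m (Suc l)
     + a (Suc l) * a (Suc (Suc l)) * dyck a m (Suc (Suc (Suc l)))" for a :: "nat \<Rightarrow> 'a" and m l
    by (simp add: algebra_simps)
  from this[of "wt t" "2 * n + 1" "2 * k"] show ?thesis
    by (cases k) (simp_all add: wt_def algebra_simps power_mult_distrib[symmetric] del: dyck.simps(2))
qed

text \<open>
  The sign \<open>(-1) ^ k\<close> in the recurrence makes the behaviour depend on the parities of \<open>n\<close> and \<open>k\<close>.
  After two applications of it the entries with \<open>k\<close> odd and \<open>n\<close> even cancel again, and what is left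
  is a recurrence with constant coefficients for \<open>D\<close>.
\<close>

lemma dyck_wt_odd:
  fixes t :: "'a::comm_ring_1" and D :: "nat \<Rightarrow> nat \<Rightarrow> 'a"
  assumes D0: "D 0 0 = 1" "\<And>j. D 0 (Suc j) = 0"
    and D1: "\<And>m. D (Suc m) 0 = (1 + t + t\<^sup>2) * D m 0 + t\<^sup>2 * D m (Suc 0)"
    and D2: "\<And>m j. D (Suc m) (Suc j) = D m j + (1 + t\<^sup>2) * D m (Suc j) + t\<^sup>2 * D m (Suc (Suc j))"
  shows "dyck (wt t) (2 * n + 1) (2 * k + 1) =
    (let m = n div 2; j = k div 2 in
     if even n then (if even k then D m j else 0)
     else (if even k then (1 + t) * D m j else D m j - t * D m (Suc j)))"
proof (induction n arbitrary: k)
  case 0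
  show ?case
  proof (cases k)
    case (Suc l)
    have "D 0 (Suc l div 2) = 0" if "odd l"
      using that by (auto elim!: oddE simp: D0)
    with Suc show ?thesis by (simp add: dyck_eq_0)
  qed (simp add: D0 wt_def)
next
  case (Suc n)
  obtain m where m: "n = 2 * m \<or> n = 2 * m + 1"
    by (metis evenE oddE)
  obtain j where j: "k = 2 * j \<or> k = 2 * j + 1"
    by (metis evenE oddE)
  from m j show ?case
    unfolding dyck_wt_odd_Suc Suc.IH
    by (cases j) (auto simp: D1 D2 Let_def algebra_simps power2_eq_square)
qed

section \<open>The \<open>q\<close>-Narayana polynomials at \<open>q = -1\<close>\<close>

lemma q_binomial_0_right [simp]: "q_binomial n 0 = 1"
  using q_binomial_exact[of 0 n] by (simp add: q_fact_nonzero)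

lemma q_binomial_self [simp]: "q_binomial n n = 1"
  using q_binomial_exact[of n n] by (simp add: q_fact_nonzero)

lemma q_pascal:
  "q_binomial (Suc n) (Suc k) = q_binomial n k + monom 1 (Suc k) * q_binomial n (Suc k)"
proof -
  consider "k > n" | "k = n" | "k < n" by linarith
  then show ?thesis
  proof cases
    case 3
    then have split: "q_bracket (Suc n) = q_bracket (Suc k) + monom 1 (Suc k) * q_bracket (n - k)"
      using q_bracket_add[of "Suc k" "n - k"] by simp
    have nk: "n - k = Suc (n - Suc k)" using 3 by simp
    have exact: "q_binomial n k * (q_fact k * q_fact (n - k)) = q_fact n"
      "q_binomial n (Suc k) * (q_fact (Suc k) * q_fact (n - Suc k)) = q_fact n"
      using 3 by (simp_all add: q_binomial_exact)
    let ?d = "q_fact (Suc k) * q_fact (n - k)"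
    have "q_binomial (Suc n) (Suc k) * ?d = q_bracket (Suc n) * q_fact n"
      using q_binomial_exact[of "Suc k" "Suc n"] 3 by (simp add: q_fact_Suc)
    also have "\<dots> = q_bracket (Suc k) * (q_binomial n k * (q_fact k * q_fact (n - k)))
        + monom 1 (Suc k) * q_bracket (n - k)
          * (q_binomial n (Suc k) * (q_fact (Suc k) * q_fact (n - Suc k)))"
      unfolding exact split by (simp add: algebra_simps)
    also have "\<dots> = (q_binomial n k + monom 1 (Suc k) * q_binomial n (Suc k)) * ?d"
      unfolding q_fact_Suc[of k] nk q_fact_Suc[of "n - Suc k"] by (simp add: algebra_simps)
    finally show ?thesis by (simp add: q_fact_nonzero)
  qed (simp_all add: q_binomial_def)
qed

lemma q_binomial_at_minus_1:
  "poly (q_binomial n k) (-1) = (if even n \<and> odd k then 0 else int ((n div 2) choose (k div 2)))"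
proof (induction n arbitrary: k)
  case 0
  show ?case by (cases k) (auto simp: q_binomial_def elim!: evenE)
next
  case (Suc n)
  show ?case
  proof (cases k)
    case (Suc l)
    obtain m where m: "n = 2 * m \<or> n = 2 * m + 1"
      by (metis evenE oddE)
    obtain j where j: "l = 2 * j \<or> l = 2 * j + 1"
      by (metis evenE oddE)
    from m j show ?thesis
      by (auto simp: Suc q_pascal Suc.IH poly_monom)
  qed simp
qed

text \<open>
  For odd \<open>k\<close> the denominator \<open>[k+1]_q\<close> vanishes at \<open>q = -1\<close>. The division is therefore carried
  out beforehand: with \<open>A, B, C, D\<close> as in the proof,
  \<open>A B = [k+1]_q (A B - q C D)\<close>, and at \<open>q = -1\<close> one of \<open>A\<close> and \<open>B\<close> vanishes.
\<close>

lemma q_narayana_coeff_at_minus_1: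
  assumes "k < n"
  shows "poly (q_narayana_coeff n k) (-1)
       = int (((n - 1) div 2) choose (k div 2)) * int ((n div 2) choose ((k + 1) div 2))"
proof (cases "even k")
  case True
  have "poly (q_bracket (k + 1)) (-1) = 1"
    using True unfolding q_bracket_def by (induction k rule: nat_induct2) (auto simp: poly_monom)
  with arg_cong[OF q_narayana_coeff_exact[OF assms], of "\<lambda>p. poly p (-1)"] True
  show ?thesis by (simp add: q_binomial_at_minus_1 poly_monom)
next
  case False
  then obtain j where k: "k = Suc j" and j: "even j" by (cases k) auto
  let ?A = "q_binomial n k" and ?B = "q_binomial (n - 1) k"
  let ?C = "q_binomial n (Suc k)" and ?D = "q_binomial (n - 1) j"
  have C: "q_bracket (Suc k) * ?C = q_bracket (n - k) * ?A"
    using assms by (rule q_binomial_Suc_right)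
  have D: "q_bracket k * ?B = q_bracket (n - k) * ?D"
    using q_binomial_Suc_right[of j "n - 1"] assms k by simp
  have "q_bracket (Suc k) * (?A * ?B - monom 1 1 * ?C * ?D)
      = q_bracket (Suc k) * ?A * ?B - monom 1 1 * (q_bracket (Suc k) * ?C) * ?D"
    by (simp add: algebra_simps)
  also have "\<dots> = q_bracket (Suc k) * ?A * ?B - monom 1 1 * ?A * (q_bracket (n - k) * ?D)"
    unfolding C by (simp add: algebra_simps)
  also have "\<dots> = ?A * ?B"
    unfolding D[symmetric] q_bracket_Suc by (simp add: algebra_simps)
  finally have AB: "q_bracket (Suc k) * (?A * ?B - monom 1 1 * ?C * ?D) = ?A * ?B" .
  have "q_bracket (Suc k) * q_narayana_coeff n k = monom 1 (k\<^sup>2 + k) * (?A * ?B)"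
    using q_narayana_coeff_exact[OF assms] by (simp add: mult_ac)
  also have "\<dots> = q_bracket (Suc k) * (monom 1 (k\<^sup>2 + k) * (?A * ?B - monom 1 1 * ?C * ?D))"
    by (subst mult.left_commute) (simp only: AB)
  finally have "q_bracket (Suc k) * q_narayana_coeff n k
      = q_bracket (Suc k) * (monom 1 (k\<^sup>2 + k) * (?A * ?B - monom 1 1 * ?C * ?D))" .
  then have "q_narayana_coeff n k = monom 1 (k\<^sup>2 + k) * (?A * ?B - monom 1 1 * ?C * ?D)"
    using q_bracket_nonzero[of "Suc k"] by simp
  moreover have "poly ?A (-1) * poly ?B (-1) = 0"
    using False assms by (simp add: q_binomial_at_minus_1)
  ultimately show ?thesis
    using j k by (simp add: q_binomial_at_minus_1 poly_monom)
qed

lemma coeff_c_poly: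
  assumes "n > 0"
  shows "coeff (c_poly n) k
       = int (((n - 1) div 2) choose (k div 2)) * int ((n div 2) choose ((k + 1) div 2))"
proof (cases "k < n")
  case True
  then have "coeff (q_narayana n) k = q_narayana_coeff n k"
    using assms by (simp add: q_narayana_def coeff_sum)
  with True show ?thesis
    by (simp add: c_poly_def coeff_map_poly q_narayana_coeff_at_minus_1)
next
  case False
  then have "coeff (q_narayana n) k = 0"
    using assms by (simp add: q_narayana_def coeff_sum)
  moreover have "(n - 1) div 2 < k div 2 \<or> n div 2 < (k + 1) div 2"
    using False assms by presburger
  ultimately show ?thesis
    by (auto simp: c_poly_def coeff_map_poly)
qed

text \<open>
  Only the odd-indexed \<open>c_n\<close> need to be identified with new objects: by Pascal's rule the next even
  one differs by the factor \<open>1 + t\<close>, exactly as the bottom entries in \<open>dyck_wt_odd\<close> do.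
\<close>

lemma c_poly_odd: "c_poly (2 * m + 1) = binom_pair_poly m 0"
  by (rule poly_eqI) (simp add: coeff_c_poly coeff_ballot)

lemma c_poly_even: "c_poly (2 * m + 2) = (1 + [:0, 1:]) * binom_pair_poly m 0"
proof (rule poly_eqI)
  fix k
  show "coeff (c_poly (2 * m + 2)) k = coeff ((1 + [:0, 1:]) * binom_pair_poly m 0) k"
    by (cases k) (simp_all add: coeff_c_poly coeff_ballot algebra_simps)
qed

lemma c_poly_eq_dyck: "c_poly n = dyck (wt [:0, 1:]) (2 * n) 0"
proof (cases n)
  case 0
  then show ?thesis by (simp add: c_poly_def q_narayana_def)
next
  case (Suc l)
  have "dyck (wt [:0, 1:]) (2 * n) 0 = dyck (wt [:0, 1 :: int:]) (2 * l + 1) (2 * 0 + 1)"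
    by (simp add: Suc wt_def)
  also have "\<dots> = (if even l then binom_pair_poly (l div 2) 0 else (1 + [:0, 1:]) * binom_pair_poly (l div 2) 0)"
    by (subst dyck_wt_odd[OF binom_pair_poly_0 binom_pair_poly_Suc_0 binom_pair_poly_Suc_Suc]) (simp add: Let_def)
  also have "\<dots> = c_poly n"
    using c_poly_odd[of "l div 2"] c_poly_even[of "l div 2"]
    by (auto simp: Suc elim!: evenE oddE)
  finally show ?thesis by simp
qed

section \<open>The Hankel determinants\<close>

theorem mainTheorem1:
  fixes n :: nat
  assumes "n \<ge> 1"
  shows "det (mat n n (\<lambda>(i, j). c_poly (i + j))) = [:0, 1:] ^ (n choose 2)
       \<and> det (mat n n (\<lambda>(i, j). c_poly (i + j + 1))) = (- [:0, 1:]) ^ (n choose 2)"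
proof
  have one_less_two: "(1 :: nat) < 2" by simp
  show "det (mat n n (\<lambda>(i, j). c_poly (i + j))) = [:0, 1:] ^ (n choose 2)"
    using det_hankel_dyck[of 0 n "wt [:0, 1:]"]
    by (simp add: c_poly_eq_dyck prod_wt_even prod_power_choose_2)
  show "det (mat n n (\<lambda>(i, j). c_poly (i + j + 1))) = (- [:0, 1:]) ^ (n choose 2)"
    using det_hankel_dyck[OF one_less_two, of n "wt [:0, 1 :: int:]"]
    unfolding c_poly_eq_dyck prod_wt_odd prod_power_choose_2 .
qed

end
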